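(* Let $d\ge2$ and $n\ge0$. The set $S^{d-1}_n\big((21,12),231\big)$ of $d$-permutations of size $n$ avoiding both the pattern $(21,12)$ and the pattern $231$ is in bijection with the set of $d$-ary trees with $n$ internal nodes.
   Context: A $d$-permutation of size $n$ is a tuple $\boldsymbol{\sigma}=(\sigma_1,\ldots,\sigma_{d-1})$ of permutations of $[n]$; put $\sigma_0=\mathrm{id}$. Its points are $(i,\sigma_1(i),\ldots,\sigma_{d-1}(i))$, $i\in[n]$, and $\sigma_l(p)$ is the $l$-th coordinate ($l=0,\ldots,d-1$) of point $p$. Pattern avoidance: for indices $0\le i_1<\cdots<i_{d'}\le d-1$ the (direct) projection is the $d'$-permutation $(\sigma_{i_2}\sigma_{i_1}^{-1},\ldots,\sigma_{i_{d'}}\sigma_{i_1}^{-1})$. $\boldsymbol\sigma$ contains a $d'$-permutation $\boldsymbol\tau=(\tau_1,\ldots,\tau_{d'-1})$ of size $k$ if some direct projection $\boldsymbol\sigma'$ of dimension $d'$ and indices $c_1<\cdots<c_k$ satisfy: $\sigma'_m(c_1)\cdots\sigma'_m(c_k)$ is order-isomorphic to $\tau_m$ for all $m$; otherwise it avoids $\boldsymbol\tau$. Here $(21,12)$ is the $3$-permutation of size $2$ with $\tau_1=21$, $\tau_2=12$: $\boldsymbol\sigma$ contains it iff there are points $p,q$ and indices $0\le i<j<k\le d-1$ with $\sigma_i(p)<\sigma_i(q)$, $\sigma_j(p)>\sigma_j(q)$, $\sigma_k(p)<\sigma_k(q)$. The pattern $231$ is the ordinary permutation (2-permutation) of size 3: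 $\boldsymbol\sigma$ contains it iff there are $0\le i<j\le d-1$ and points $a,b,c$ with $\sigma_i(a)<\sigma_i(b)<\sigma_i(c)$ and $\sigma_j(c)<\sigma_j(a)<\sigma_j(b)$. A $d$-ary tree is a rooted tree in which each node has either $0$ or $d$ distinguishable (ordered) children; nodes with children are internal. *)

theory Defs
  imports "HOL-Combinatorics.Permutations"
begin

text \<open>The tuple \<open>(\<sigma>\<^sub>1, \<dots>, \<sigma>\<^sub>d\<^sub>-\<^sub>1)\<close> is a list of length \<open>d - 1\<close>; permutations of \<open>[n]\<close> are
  functions that are the identity outside \<open>{1..n}\<close>, so each tuple has a unique representation.\<close>

type_synonym mperm = "(nat \<Rightarrow> nat) list"

definition d_permutations :: "nat \<Rightarrow> nat \<Rightarrow> mperm set" where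
  "d_permutations d n = {\<sigma>. length \<sigma> + 1 = d \<and> (\<forall>s \<in> set \<sigma>. s permutes {1..n})}"

text \<open>\<open>component \<sigma> l\<close> is \<open>\<sigma>\<^sub>l\<close>, with \<open>\<sigma>\<^sub>0 = id\<close>.\<close>

definition component :: "mperm \<Rightarrow> nat \<Rightarrow> nat \<Rightarrow> nat" where
  "component \<sigma> l = (id # \<sigma>) ! l"

definition projection :: "mperm \<Rightarrow> nat list \<Rightarrow> mperm" where
  "projection \<sigma> is = map (\<lambda>i. component \<sigma> i \<circ> inv (component \<sigma> (hd is))) (tl is)"

definition direct_projections :: "mperm \<Rightarrow> nat \<Rightarrow> mperm set" where
  "direct_projections \<sigma> d' =
     {projection \<sigma> is |is. length is = d' \<and> sorted_wrt (<) is \<and> set is \<subseteq> {0..length \<sigma>}}"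

text \<open>\<open>contains n \<sigma> k \<tau>\<close>: the multidimensional permutation \<open>\<sigma>\<close> of size \<open>n\<close> contains the pattern
  \<open>\<tau>\<close> of size \<open>k\<close>. The sizes are explicit because they cannot be read off the lists; the
  dimension of \<open>\<tau>\<close> is \<open>length \<tau> + 1\<close>.\<close>

definition contains :: "nat \<Rightarrow> mperm \<Rightarrow> nat \<Rightarrow> mperm \<Rightarrow> bool" where
  "contains n \<sigma> k \<tau> \<longleftrightarrow>
     (\<exists>\<sigma>' \<in> direct_projections \<sigma> (length \<tau> + 1). \<exists>c.
        strict_mono_on {1..k} c \<and> c ` {1..k} \<subseteq> {1..n} \<and>
        (\<forall>m < length \<tau>. \<forall>a \<in> {1..k}. \<forall>b \<in> {1..k}.
           (\<sigma>' ! m) (c a) < (\<sigma>' ! m) (c b) \<longleftrightarrow> (\<tau> ! m) a < (\<tau> ! m) b))"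

abbreviation avoids :: "nat \<Rightarrow> mperm \<Rightarrow> nat \<Rightarrow> mperm \<Rightarrow> bool" where
  "avoids n \<sigma> k \<tau> \<equiv> \<not> contains n \<sigma> k \<tau>"

definition one_line :: "nat list \<Rightarrow> nat \<Rightarrow> nat" where
  "one_line w i = (if i \<in> {1..length w} then w ! (i - 1) else i)"

definition pat_21_12 :: mperm where
  "pat_21_12 = [one_line [2, 1], one_line [1, 2]]"

definition pat_231 :: mperm where
  "pat_231 = [one_line [2, 3, 1]]"

definition avoiders :: "nat \<Rightarrow> nat \<Rightarrow> mperm set" where
  "avoiders d n = {\<sigma> \<in> d_permutations d n. avoids n \<sigma> 2 pat_21_12 \<and> avoids n \<sigma> 3 pat_231}"

datatype ordered_tree = Node "ordered_tree list"

fun d_ary :: "nat \<Rightarrow> ordered_tree \<Rightarrow> bool" where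
  "d_ary d (Node ts) \<longleftrightarrow> (length ts = 0 \<or> length ts = d) \<and> (\<forall>t \<in> set ts. d_ary d t)"

fun internal_nodes :: "ordered_tree \<Rightarrow> nat" where
  "internal_nodes (Node ts) = (if ts = [] then 0 else 1 + sum_list (map internal_nodes ts))"

definition d_ary_trees :: "nat \<Rightarrow> nat \<Rightarrow> ordered_tree set" where
  "d_ary_trees d n = {t. d_ary d t \<and> internal_nodes t = n}"

lemma component_permutes:
  assumes "\<sigma> \<in> d_permutations d n" "l < d"
  shows "component \<sigma> l permutes {1..n}"
  using assms by (cases l) (auto simp: d_permutations_def component_def permutes_id id_def[symmetric])

lemma contains_231_iff:
  assumes "\<sigma> \<in> d_permutations d n"
  shows "contains n \<sigma> 3 pat_231 \<longleftrightarrow>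
    (\<exists>i j. i < j \<and> j < d \<and> (\<exists>a\<in>{1..n}. \<exists>b\<in>{1..n}. \<exists>c\<in>{1..n}.
       component \<sigma> i a < component \<sigma> i b \<and> component \<sigma> i b < component \<sigma> i c \<and>
       component \<sigma> j c < component \<sigma> j a \<and> component \<sigma> j a < component \<sigma> j b))"
    (is "_ \<longleftrightarrow> ?R")
proof
  assume "contains n \<sigma> 3 pat_231"
  then obtain \<rho> f where \<rho>: "\<rho> \<in> direct_projections \<sigma> 2"
    and f: "strict_mono_on {1..3::nat} f" "f ` {1..3} \<subseteq> {1..n}"
    and o: "\<forall>a \<in> {1..3}. \<forall>b \<in> {1..3}. (\<rho> ! 0) (f a) < (\<rho> ! 0) (f b) \<longleftrightarrow>
        one_line [2,3,1] a < one_line [2,3,1] b"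
    unfolding contains_def pat_231_def by (simp add: numeral_2_eq_2) blast
  from \<rho> obtain "is" where L: "length is = 2" "sorted_wrt (<) is" "set is \<subseteq> {0..length \<sigma>}"
    and r: "\<rho> = projection \<sigma> is"
    unfolding direct_projections_def by blast
  from L(1) obtain i j where ij: "is = [i, j]"
    by (auto simp: numeral_2_eq_2 length_Suc_conv)
  define g where "g = inv (component \<sigma> i)"
  have jd: "i < j" "j < d" using L ij assms by (auto simp: d_permutations_def)
  have p: "component \<sigma> i permutes {1..n}" using component_permutes assms jd by simp
  have gi: "component \<sigma> i (g x) = x" for x
    unfolding g_def using permutes_inverses(1)[OF p] .
  have gin: "g x \<in> {1..n}" if "x \<in> {1..n}" for x
    unfolding g_def using permutes_in_image[OF permutes_inv[OF p]] that by blast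
  have fin: "f 1 \<in> {1..n}" "f 2 \<in> {1..n}" "f 3 \<in> {1..n}"
    using f(2) by (auto simp: image_subset_iff)
  have "f 1 < f 2" "f 2 < f 3"
    using f(1) by (auto simp: strict_mono_on_def)
  then have "component \<sigma> i (g (f 1)) < component \<sigma> i (g (f 2))"
      "component \<sigma> i (g (f 2)) < component \<sigma> i (g (f 3))"
    by (simp_all add: gi)
  moreover have "component \<sigma> j (g (f 3)) < component \<sigma> j (g (f 1))"
      "component \<sigma> j (g (f 1)) < component \<sigma> j (g (f 2))"
    using o[rule_format, of 3 1] o[rule_format, of 1 2]
    by (simp_all add: r projection_def ij g_def one_line_def)
  ultimately show ?R
    using jd fin[THEN gin] by blast
next
  assume ?R
  then obtain i j a b c where ij: "i < j" "j < d" and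
    abc: "a\<in>{1..n}" "b\<in>{1..n}" "c\<in>{1..n}" and
    lt: "component \<sigma> i a < component \<sigma> i b" "component \<sigma> i b < component \<sigma> i c"
      "component \<sigma> j c < component \<sigma> j a" "component \<sigma> j a < component \<sigma> j b" by blast
  define s where "s = component \<sigma> i"
  have p: "s permutes {1..n}" unfolding s_def using component_permutes assms ij by simp
  define f where "f x = (if x = 1 then s a else if x = 2 then s b else s c)" for x :: nat
  have set3: "{1..3::nat} = {1, 2, 3}" by auto
  have "projection \<sigma> [i, j] \<in> direct_projections \<sigma> (length pat_231 + 1)"
    unfolding direct_projections_def using ij assms
    by (intro CollectI exI[of _ "[i, j]"]) (auto simp: pat_231_def d_permutations_def)
  moreover have "strict_mono_on {1..3} f"
    using lt unfolding set3 by (auto simp: strict_mono_on_def f_def s_def)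
  moreover have "f ` {1..3} \<subseteq> {1..n}"
    unfolding set3 using abc permutes_in_image[OF p] by (simp add: f_def)
  moreover have "\<forall>m < length pat_231. \<forall>x \<in> {1..3}. \<forall>y \<in> {1..3}.
      (projection \<sigma> [i, j] ! m) (f x) < (projection \<sigma> [i, j] ! m) (f y) \<longleftrightarrow>
      (pat_231 ! m) x < (pat_231 ! m) y"
    unfolding set3 using lt permutes_inverses(2)[OF p]
    by (auto simp: pat_231_def projection_def f_def one_line_def s_def)
  ultimately show "contains n \<sigma> 3 pat_231" unfolding contains_def by blast
qed

lemma contains_21_12_iff:
  assumes "\<sigma> \<in> d_permutations d n"
  shows "contains n \<sigma> 2 pat_21_12 \<longleftrightarrow>
    (\<exists>i j k. i < j \<and> j < k \<and> k < d \<and> (\<exists>p\<in>{1..n}. \<exists>q\<in>{1..n}.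
       component \<sigma> i p < component \<sigma> i q \<and> component \<sigma> j p > component \<sigma> j q \<and>
       component \<sigma> k p < component \<sigma> k q))"
    (is "_ \<longleftrightarrow> ?R")
proof
  have l: "length pat_21_12 = 2" by (simp add: pat_21_12_def)
  assume "contains n \<sigma> 2 pat_21_12"
  then obtain \<rho> f where \<rho>: "\<rho> \<in> direct_projections \<sigma> 3"
    and f: "strict_mono_on {1..2::nat} f" "f ` {1..2} \<subseteq> {1..n}"
    and o: "\<forall>m < 2. \<forall>a \<in> {1..2}. \<forall>b \<in> {1..2}. (\<rho> ! m) (f a) < (\<rho> ! m) (f b) \<longleftrightarrow>
        (pat_21_12 ! m) a < (pat_21_12 ! m) b"
    unfolding contains_def by (simp add: l) blast
  from \<rho> obtain "is" where L: "length is = 3" "sorted_wrt (<) is" "set is \<subseteq> {0..length \<sigma>}"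
    and r: "\<rho> = projection \<sigma> is"
    unfolding direct_projections_def by blast
  from L(1) obtain i j k where ij: "is = [i, j, k]"
    by (auto simp: numeral_3_eq_3 length_Suc_conv)
  define g where "g = inv (component \<sigma> i)"
  have jd: "i < j" "j < k" "k < d" using L ij assms by (auto simp: d_permutations_def)
  have p: "component \<sigma> i permutes {1..n}" using component_permutes assms jd by simp
  have gi: "component \<sigma> i (g x) = x" for x
    unfolding g_def using permutes_inverses(1)[OF p] .
  have gin: "g x \<in> {1..n}" if "x \<in> {1..n}" for x
    unfolding g_def using permutes_in_image[OF permutes_inv[OF p]] that by blast
  have fin: "f 1 \<in> {1..n}" "f 2 \<in> {1..n}"
    using f(2) by (auto simp: image_subset_iff)
  have "f 1 < f 2"
    using f(1) by (auto simp: strict_mono_on_def)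
  then have "component \<sigma> i (g (f 1)) < component \<sigma> i (g (f 2))"
    by (simp add: gi)
  moreover have "component \<sigma> j (g (f 2)) < component \<sigma> j (g (f 1))"
      "component \<sigma> k (g (f 1)) < component \<sigma> k (g (f 2))"
    using o[rule_format, of 0 2 1] o[rule_format, of 1 1 2]
    by (simp_all add: r projection_def ij g_def one_line_def pat_21_12_def)
  ultimately show ?R
    using jd fin[THEN gin] by blast
next
  assume ?R
  then obtain i j k a b where ij: "i < j" "j < k" "k < d" and
    abc: "a\<in>{1..n}" "b\<in>{1..n}" and
    lt: "component \<sigma> i a < component \<sigma> i b" "component \<sigma> j b < component \<sigma> j a"
      "component \<sigma> k a < component \<sigma> k b" by blast
  define s where "s = component \<sigma> i"
  have p: "s permutes {1..n}" unfolding s_def using component_permutes assms ij by simp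
  define f where "f x = (if x = 1 then s a else s b)" for x :: nat
  have set2: "{1..2::nat} = {1, 2}" by auto
  have "projection \<sigma> [i, j, k] \<in> direct_projections \<sigma> (length pat_21_12 + 1)"
    unfolding direct_projections_def using ij assms
    by (intro CollectI exI[of _ "[i, j, k]"]) (auto simp: pat_21_12_def d_permutations_def)
  moreover have "strict_mono_on {1..2} f"
    using lt unfolding set2 by (auto simp: strict_mono_on_def f_def s_def)
  moreover have "f ` {1..2} \<subseteq> {1..n}"
    unfolding set2 using abc permutes_in_image[OF p] by (simp add: f_def)
  moreover have "\<forall>m < length pat_21_12. \<forall>x \<in> {1..2}. \<forall>y \<in> {1..2}.
      (projection \<sigma> [i, j, k] ! m) (f x) < (projection \<sigma> [i, j, k] ! m) (f y) \<longleftrightarrow>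
      (pat_21_12 ! m) x < (pat_21_12 ! m) y"
    unfolding set2 using lt permutes_inverses(2)[OF p]
    by (auto simp: pat_21_12_def projection_def f_def one_line_def s_def less_Suc_eq numeral_2_eq_2)
  ultimately show "contains n \<sigma> 2 pat_21_12" unfolding contains_def by blast
qed

end

theory Submission
  imports Defs
begin

text \<open>View a \<open>d\<close>-permutation as a finite set of points with \<open>d\<close> strict linear orders. Let \<open>r\<close> be the
  first point of the order \<open>0\<close>. Avoiding \<open>(21,12)\<close> means that every other point lies above \<open>r\<close> in
  the orders \<open>0, \<dots>, l\<close> and below \<open>r\<close> in all later ones, for some \<open>l < d\<close>; this splits the other
  points into classes \<open>C\<^sub>0, \<dots>, C\<^sub>d\<^sub>-\<^sub>1\<close>. Avoiding \<open>231\<close> forces \<open>C\<^sub>l\<close> to lie entirely below \<open>C\<^sub>m\<close> in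
  every order whenever \<open>l < m\<close>, so the order \<open>i\<close> reads
  \<open>C\<^sub>0 < \<dots> < C\<^sub>i\<^sub>-\<^sub>1 < r < C\<^sub>i < \<dots> < C\<^sub>d\<^sub>-\<^sub>1\<close>. Recursively, the points are the internal nodes of a
  \<open>d\<close>-ary tree, and the order \<open>i\<close> is the traversal visiting a node just before its child \<open>i\<close>.\<close>

section \<open>Finite sets with several linear orders\<close>

text \<open>All conditions are relativised to \<open>P\<close>, so the same family \<open>R\<close>
  can be kept while the recursion passes to smaller and smaller sets of points.\<close>

definition linear_orders :: "nat \<Rightarrow> 'a set \<Rightarrow> (nat \<Rightarrow> 'a \<Rightarrow> 'a \<Rightarrow> bool) \<Rightarrow> bool" where
  "linear_orders d P R \<longleftrightarrow> finite P \<and>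
     (\<forall>i<d. \<forall>p\<in>P. \<not> R i p p) \<and>
     (\<forall>i<d. \<forall>p\<in>P. \<forall>q\<in>P. \<forall>s\<in>P. R i p q \<longrightarrow> R i q s \<longrightarrow> R i p s) \<and>
     (\<forall>i<d. \<forall>p\<in>P. \<forall>q\<in>P. p = q \<or> R i p q \<or> R i q p)"

text \<open>The point forms of avoidance from \<open>contains_21_12_iff\<close> and
  \<open>contains_231_iff\<close>, with abstract orders in place of comparisons of coordinates. This
  makes them meaningful for subsets of points and for nodes of trees.\<close>

definition avoiding_orders :: "nat \<Rightarrow> 'a set \<Rightarrow> (nat \<Rightarrow> 'a \<Rightarrow> 'a \<Rightarrow> bool) \<Rightarrow> bool" where
  "avoiding_orders d P R \<longleftrightarrow>
     (\<forall>i j k. i < j \<longrightarrow> j < k \<longrightarrow> k < d \<longrightarrow>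
        (\<forall>p\<in>P. \<forall>q\<in>P. \<not> (R i p q \<and> R j q p \<and> R k p q))) \<and>
     (\<forall>i j. i < j \<longrightarrow> j < d \<longrightarrow>
        (\<forall>a\<in>P. \<forall>b\<in>P. \<forall>c\<in>P. \<not> (R i a b \<and> R i b c \<and> R j c a \<and> R j a b)))"

definition orders_iso ::
  "nat \<Rightarrow> 'a set \<Rightarrow> (nat \<Rightarrow> 'a \<Rightarrow> 'a \<Rightarrow> bool) \<Rightarrow> 'b set \<Rightarrow> (nat \<Rightarrow> 'b \<Rightarrow> 'b \<Rightarrow> bool) \<Rightarrow> ('a \<Rightarrow> 'b) \<Rightarrow> bool"
  where "orders_iso d P R Q S \<phi> \<longleftrightarrow> bij_betw \<phi> P Q \<and>
     (\<forall>i<d. \<forall>p\<in>P. \<forall>q\<in>P. S i (\<phi> p) (\<phi> q) \<longleftrightarrow> R i p q)"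

lemma linear_orders_subset:
  "linear_orders d P R \<Longrightarrow> Q \<subseteq> P \<Longrightarrow> linear_orders d Q R"
  unfolding linear_orders_def by (meson finite_subset subsetD)

lemma avoiding_orders_subset:
  "avoiding_orders d P R \<Longrightarrow> Q \<subseteq> P \<Longrightarrow> avoiding_orders d Q R"
  unfolding avoiding_orders_def by (meson subsetD)

lemma orders_iso_inv:
  assumes "orders_iso d P R Q S \<phi>"
  shows "orders_iso d Q S P R (inv_into P \<phi>)"
proof -
  have b: "bij_betw \<phi> P Q" using assms by (simp add: orders_iso_def)
  have "inv_into P \<phi> q \<in> P \<and> \<phi> (inv_into P \<phi> q) = q" if "q \<in> Q" for q
    using b that by (metis bij_betw_def f_inv_into_f inv_into_into)
  then show ?thesis
    using assms bij_betw_inv_into[OF b] unfolding orders_iso_def by metis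
qed

lemma orders_iso_comp:
  assumes "orders_iso d P R Q S \<phi>" "orders_iso d Q S Q' S' \<psi>"
  shows "orders_iso d P R Q' S' (\<psi> \<circ> \<phi>)"
proof -
  have "\<phi> p \<in> Q" if "p \<in> P" for p
    using assms(1) that unfolding orders_iso_def by (auto dest: bij_betwE)
  then show ?thesis
    using assms unfolding orders_iso_def by (auto intro: bij_betw_trans)
qed

lemma avoiding_orders_iso:
  assumes "orders_iso d P R Q S \<phi>" "avoiding_orders d Q S"
  shows "avoiding_orders d P R"
proof -
  have i: "\<phi> p \<in> Q" if "p \<in> P" for p
    using assms(1) that unfolding orders_iso_def by (auto dest: bij_betwE)
  have R: "R i p q \<longleftrightarrow> S i (\<phi> p) (\<phi> q)" if "i < d" "p \<in> P" "q \<in> P" for i p q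
    using assms(1) that unfolding orders_iso_def by blast
  show ?thesis
    unfolding avoiding_orders_def
  proof (intro conjI allI impI ballI)
    fix i j k p q assume "i < j" "j < k" "k < d" "p \<in> P" "q \<in> P"
    moreover from this have "i < d" "j < d" by auto
    ultimately show "\<not> (R i p q \<and> R j q p \<and> R k p q)"
      using assms(2) i unfolding avoiding_orders_def by (metis R)
  next
    fix i j a b c assume "i < j" "j < d" "a \<in> P" "b \<in> P" "c \<in> P"
    moreover from this have "i < d" by auto
    ultimately show "\<not> (R i a b \<and> R i b c \<and> R j c a \<and> R j a b)"
      using assms(2) i unfolding avoiding_orders_def by (metis R)
  qed
qed

section \<open>Ranks in a linear order\<close>

text \<open>Counting the points not above \<open>p\<close> includes \<open>p\<close> itself, so
  ranks start at 1 and range over \<open>{1..card P}\<close>.\<close>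

definition rank :: "'a set \<Rightarrow> ('a \<Rightarrow> 'a \<Rightarrow> bool) \<Rightarrow> 'a \<Rightarrow> nat" where
  "rank P r p = card {q \<in> P. \<not> r p q}"

lemma orders_iso_rank:
  assumes "orders_iso d P R Q S \<phi>" "i < d" "p \<in> P"
  shows "rank Q (S i) (\<phi> p) = rank P (R i) p"
proof -
  have b: "bij_betw \<phi> P Q" using assms by (simp add: orders_iso_def)
  have "\<phi> ` {q \<in> P. \<not> R i p q} = {q \<in> Q. \<not> S i (\<phi> p) q}"
    using assms b unfolding orders_iso_def bij_betw_def by auto
  moreover have "inj_on \<phi> {q \<in> P. \<not> R i p q}"
    using b by (auto simp: bij_betw_def intro: inj_on_subset)
  ultimately show ?thesis
    unfolding rank_def using card_image[of \<phi> "{q \<in> P. \<not> R i p q}"] by simp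
qed

lemma rank_less:
  assumes "linear_orders d P R" "i < d" "p \<in> P" "q \<in> P" "R i p q"
  shows "rank P (R i) p < rank P (R i) q"
  unfolding rank_def
proof (rule psubset_card_mono)
  show "finite {s \<in> P. \<not> R i q s}"
    using assms(1) by (simp add: linear_orders_def)
  show "{s \<in> P. \<not> R i p s} \<subset> {s \<in> P. \<not> R i q s}"
  proof
    have "R i p s" if "s \<in> P" "R i q s" for s
      using assms that unfolding linear_orders_def by metis
    then show "{s \<in> P. \<not> R i p s} \<subseteq> {s \<in> P. \<not> R i q s}" by blast
    have "q \<in> {s \<in> P. \<not> R i q s}" "q \<notin> {s \<in> P. \<not> R i p s}"
      using assms unfolding linear_orders_def by auto
    then show "{s \<in> P. \<not> R i p s} \<noteq> {s \<in> P. \<not> R i q s}" by blast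
  qed
qed

lemma rank_less_iff:
  assumes "linear_orders d P R" "i < d" "p \<in> P" "q \<in> P"
  shows "rank P (R i) p < rank P (R i) q \<longleftrightarrow> R i p q"
proof -
  have "p = q \<or> R i p q \<or> R i q p"
    using assms unfolding linear_orders_def by blast
  then show ?thesis
    using rank_less[OF assms(1,2)] assms(3,4) by (metis less_asym less_irrefl)
qed

lemma bij_betw_rank:
  assumes "linear_orders d P R" "i < d"
  shows "bij_betw (rank P (R i)) P {1..card P}"
proof -
  have fin: "finite P" using assms by (simp add: linear_orders_def)
  have inj: "inj_on (rank P (R i)) P"
  proof (rule inj_onI)
    fix p q assume pq: "p \<in> P" "q \<in> P" "rank P (R i) p = rank P (R i) q"
    have "p = q \<or> R i p q \<or> R i q p"
      using assms pq unfolding linear_orders_def by blast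
    then show "p = q" using rank_less_iff[OF assms] pq by (metis less_irrefl)
  qed
  have "rank P (R i) p \<in> {1..card P}" if "p \<in> P" for p
  proof -
    have "p \<in> {q \<in> P. \<not> R i p q}"
      using that assms unfolding linear_orders_def by auto
    then have "rank P (R i) p > 0"
      unfolding rank_def using fin by (auto simp: card_gt_0_iff)
    moreover have "rank P (R i) p \<le> card P"
      unfolding rank_def using fin by (auto intro: card_mono)
    ultimately show ?thesis by simp
  qed
  then have "rank P (R i) ` P = {1..card P}"
    using inj by (intro card_subset_eq) (auto simp: card_image)
  with inj show ?thesis by (simp add: bij_betw_def)
qed

section \<open>Multidimensional permutations as families of linear orders\<close>

definition point_orders :: "mperm \<Rightarrow> nat \<Rightarrow> nat \<Rightarrow> nat \<Rightarrow> bool" where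
  "point_orders \<sigma> i p q \<longleftrightarrow> component \<sigma> i p < component \<sigma> i q"

lemma linear_orders_point_orders:
  assumes "\<sigma> \<in> d_permutations d n"
  shows "linear_orders d {1..n} (point_orders \<sigma>)"
proof -
  have "p = q" if "i < d" "component \<sigma> i p = component \<sigma> i q" for i p q
    using permutes_inj[OF component_permutes[OF assms that(1)]] that(2) by (simp add: inj_eq)
  then have "p = q \<or> component \<sigma> i p < component \<sigma> i q \<or> component \<sigma> i q < component \<sigma> i p"
    if "i < d" for i p q
    using that by (meson nat_neq_iff)
  then show ?thesis
    unfolding linear_orders_def point_orders_def by auto
qed

lemma avoiding_orders_point_orders:
  assumes "\<sigma> \<in> d_permutations d n"
  shows "avoiding_orders d {1..n} (point_orders \<sigma>) \<longleftrightarrow> \<sigma> \<in> avoiders d n"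
proof -
  have "avoids n \<sigma> 2 pat_21_12 \<longleftrightarrow> (\<forall>i j k. i < j \<longrightarrow> j < k \<longrightarrow> k < d \<longrightarrow>
      (\<forall>p\<in>{1..n}. \<forall>q\<in>{1..n}.
        \<not> (point_orders \<sigma> i p q \<and> point_orders \<sigma> j q p \<and> point_orders \<sigma> k p q)))"
    unfolding contains_21_12_iff[OF assms] point_orders_def
    by (simp only: not_ex de_Morgan_conj bex_simps ball_simps imp_conv_disj disj_assoc)
  moreover have "avoids n \<sigma> 3 pat_231 \<longleftrightarrow> (\<forall>i j. i < j \<longrightarrow> j < d \<longrightarrow>
      (\<forall>a\<in>{1..n}. \<forall>b\<in>{1..n}. \<forall>c\<in>{1..n}. \<not> (point_orders \<sigma> i a b \<and>
        point_orders \<sigma> i b c \<and> point_orders \<sigma> j c a \<and> point_orders \<sigma> j a b)))"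
    unfolding contains_231_iff[OF assms] point_orders_def
    by (simp only: not_ex de_Morgan_conj bex_simps ball_simps imp_conv_disj disj_assoc)
  ultimately show ?thesis
    using assms unfolding avoiders_def avoiding_orders_def by (simp only: mem_Collect_eq simp_thms)
qed

text \<open>The component maps the points not above \<open>p\<close> bijectively onto the initial
  segment ending at its value at \<open>p\<close>. Hence the coordinates can be read off from the
  orders alone.\<close>

lemma rank_point_orders:
  assumes "\<sigma> \<in> d_permutations d n" "i < d" "p \<in> {1..n}"
  shows "rank {1..n} (point_orders \<sigma> i) p = component \<sigma> i p"
proof -
  let ?s = "component \<sigma> i"
  have s: "?s permutes {1..n}" using component_permutes assms by blast
  have sp: "?s p \<in> {1..n}" using permutes_in_image[OF s] assms(3) by blast
  have "?s ` {q \<in> {1..n}. \<not> ?s p < ?s q} = {1..?s p}"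
  proof
    have "?s q \<ge> 1" if "q \<in> {1..n}" for q
      using permutes_in_image[OF s, of q] that by simp
    then show "?s ` {q \<in> {1..n}. \<not> ?s p < ?s q} \<subseteq> {1..?s p}" by auto
    show "{1..?s p} \<subseteq> ?s ` {q \<in> {1..n}. \<not> ?s p < ?s q}"
    proof
      fix y assume y: "y \<in> {1..?s p}"
      then have "y \<in> ?s ` {1..n}" using permutes_image[OF s] sp by auto
      with y show "y \<in> ?s ` {q \<in> {1..n}. \<not> ?s p < ?s q}" by auto
    qed
  qed
  moreover have "inj_on ?s {q \<in> {1..n}. \<not> ?s p < ?s q}"
    using permutes_inj[OF s] by (meson inj_on_subset subset_UNIV)
  ultimately have "card {q \<in> {1..n}. \<not> ?s p < ?s q} = card {1..?s p}"
    using card_image[of ?s "{q \<in> {1..n}. \<not> ?s p < ?s q}"] by simp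
  then show ?thesis
    unfolding rank_def point_orders_def by simp
qed

text \<open>Isomorphisms preserve ranks, which are the coordinates here. Coordinate 0 is the
  identity, so \<open>\<phi>\<close> fixes every point, and then all other coordinates agree
  too.\<close>

lemma d_permutations_eqI:
  assumes \<sigma>: "\<sigma> \<in> d_permutations d n" and \<tau>: "\<tau> \<in> d_permutations d n"
    and iso: "orders_iso d {1..n} (point_orders \<sigma>) {1..n} (point_orders \<tau>) \<phi>"
  shows "\<sigma> = \<tau>"
proof (rule nth_equalityI)
  have len: "length \<sigma> + 1 = d" "length \<tau> + 1 = d"
    using \<sigma> \<tau> by (auto simp: d_permutations_def)
  then show "length \<sigma> = length \<tau>" by simp
  have eq: "component \<tau> i (\<phi> p) = component \<sigma> i p" if "i < d" "p \<in> {1..n}" for i p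
  proof -
    have "\<phi> p \<in> {1..n}"
      using iso that(2) unfolding orders_iso_def by (metis bij_betwE)
    then show ?thesis
      using orders_iso_rank[OF iso that] rank_point_orders[OF \<sigma> that]
        rank_point_orders[OF \<tau> that(1)] by simp
  qed
  have \<phi>: "\<phi> p = p" if "p \<in> {1..n}" for p
    using eq[of 0 p] that len by (simp add: component_def)
  fix l assume l: "l < length \<sigma>"
  have perm: "component \<sigma> (Suc l) permutes {1..n}" "component \<tau> (Suc l) permutes {1..n}"
    using component_permutes \<sigma> \<tau> len l by auto
  have "component \<sigma> (Suc l) p = component \<tau> (Suc l) p" for p
  proof (cases "p \<in> {1..n}")
    case True
    then show ?thesis using eq[of "Suc l" p] \<phi> len l by simp
  next
    case False
    then show ?thesis using perm by (simp add: permutes_not_in)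
  qed
  then have "component \<sigma> (Suc l) = component \<tau> (Suc l)" ..
  then show "\<sigma> ! l = \<tau> ! l" by (simp add: component_def)
qed

text \<open>Each point is named by its rank in order 0, and component \<open>i\<close> sends this
  name to the rank in order \<open>i\<close>.\<close>

lemma linear_orders_standardise:
  assumes lin: "linear_orders d P R" and d: "d > 0" and n: "card P = n"
  obtains \<sigma> \<phi> where "\<sigma> \<in> d_permutations d n"
    "orders_iso d {1..n} (point_orders \<sigma>) P R \<phi>"
proof -
  define rk where "rk i = rank P (R i)" for i
  have rk: "bij_betw (rk i) P {1..n}" if "i < d" for i
    using bij_betw_rank[OF lin that] n by (simp add: rk_def)
  define \<psi> where "\<psi> = inv_into P (rk 0)"
  have \<psi>: "bij_betw \<psi> {1..n} P"
    unfolding \<psi>_def using bij_betw_inv_into rk d by blast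
  \<comment> \<open>The identity outside \<open>{1..n}\<close> is what \<open>permutes\<close>
    demands.\<close>
  define s where "s i k = (if k \<in> {1..n} then rk i (\<psi> k) else k)" for i k
  \<comment> \<open>Index 0 is left out because \<open>component\<close> supplies the identity
    there; \<open>s0\<close> confirms that this is what \<open>s 0\<close> is.\<close>
  define \<sigma> where "\<sigma> = map s [1..<d]"
  have s: "s i permutes {1..n}" if "i < d" for i
  proof (rule bij_imp_permutes)
    have "bij_betw (rk i \<circ> \<psi>) {1..n} {1..n}" using bij_betw_trans[OF \<psi> rk[OF that]] .
    then show "bij_betw (s i) {1..n} {1..n}"
      by (rule bij_betw_cong[THEN iffD1, rotated]) (simp add: s_def)
  qed (auto simp: s_def)
  have s0: "s 0 = id"
  proof
    fix k show "s 0 k = id k"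
      using bij_betw_inv_into_right[OF rk[OF d]] by (auto simp: s_def \<psi>_def)
  qed
  have comp: "component \<sigma> i = s i" if "i < d" for i
    using that s0 by (cases i) (auto simp: component_def \<sigma>_def)
  have "\<sigma> \<in> d_permutations d n"
    using d s by (auto simp: d_permutations_def \<sigma>_def)
  moreover have "R i (\<psi> p) (\<psi> q) \<longleftrightarrow> point_orders \<sigma> i p q"
    if "i < d" "p \<in> {1..n}" "q \<in> {1..n}" for i p q
  proof -
    have "\<psi> p \<in> P" "\<psi> q \<in> P" using \<psi> that by (auto dest: bij_betwE)
    then show ?thesis
      using rank_less_iff[OF lin that(1)] that by (simp add: point_orders_def comp s_def rk_def)
  qed
  ultimately show ?thesis
    using \<psi> that unfolding orders_iso_def by blast
qed

section \<open>Internal nodes as addresses\<close>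

text \<open>An internal node is addressed by the list of child indices leading to it.\<close>

fun is_internal :: "ordered_tree \<Rightarrow> nat list \<Rightarrow> bool" where
  "is_internal (Node ts) [] \<longleftrightarrow> ts \<noteq> []"
| "is_internal (Node ts) (l # p) \<longleftrightarrow> l < length ts \<and> is_internal (ts ! l) p"

definition paths :: "ordered_tree \<Rightarrow> nat list set" where
  "paths t = Collect (is_internal t)"

lemma paths_Node:
  "paths (Node ts) =
     (if ts = [] then {} else insert [] (\<Union>l<length ts. (#) l ` paths (ts ! l)))"
proof (intro set_eqI)
  fix p show "p \<in> paths (Node ts) \<longleftrightarrow>
    p \<in> (if ts = [] then {} else insert [] (\<Union>l<length ts. (#) l ` paths (ts ! l)))"
    by (cases p) (auto simp: paths_def)
qed

lemma Cons_in_paths_iff [simp]: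
  "l # p \<in> paths (Node ts) \<longleftrightarrow> l < length ts \<and> p \<in> paths (ts ! l)"
  by (simp add: paths_def)

lemma Nil_in_paths_iff [simp]: "[] \<in> paths (Node ts) \<longleftrightarrow> ts \<noteq> []"
  by (simp add: paths_def)

lemma finite_paths: "finite (paths t)"
  by (induction t) (auto simp: paths_Node)

lemma card_paths: "card (paths t) = internal_nodes t"
proof (induction t)
  case (Node ts)
  show ?case
  proof (cases "ts = []")
    case False
    have "card (\<Union>l<length ts. (#) l ` paths (ts ! l)) =
        (\<Sum>l<length ts. card ((#) l ` paths (ts ! l)))"
      by (rule card_UN_disjoint) (auto simp: finite_paths)
    also have "\<dots> = (\<Sum>l<length ts. internal_nodes (ts ! l))"
      using Node by (intro sum.cong) (auto simp: card_image)
    also have "\<dots> = sum_list (map internal_nodes ts)"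
      by (simp add: sum_list_sum_nth atLeast0LessThan)
    finally show ?thesis
      using False by (subst paths_Node) (auto simp: finite_paths card_insert_if)
  qed (simp add: paths_Node)
qed

section \<open>Traversal orders on addresses\<close>

text \<open>Two addresses are compared where they part. If neither extends the other, left precedes
  right whatever \<open>i\<close> is; a node precedes its descendants through children
  \<open>i\<close> and later, and follows those through earlier children. For \<open>i = 0\<close>
  this is preorder.\<close>

fun before :: "nat \<Rightarrow> nat list \<Rightarrow> nat list \<Rightarrow> bool" where
  "before i [] [] \<longleftrightarrow> False"
| "before i [] (l # p) \<longleftrightarrow> i \<le> l"
| "before i (l # p) [] \<longleftrightarrow> l < i"
| "before i (l # p) (m # q) \<longleftrightarrow> l < m \<or> l = m \<and> before i p q"

lemma before_irrefl [simp]: "\<not> before i p p"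
  by (induction p) auto

lemma before_trans: "before i p q \<Longrightarrow> before i q s \<Longrightarrow> before i p s"
proof (induction i p q arbitrary: s rule: before.induct)
  case (2 i l p) then show ?case by (cases s) auto
next
  case (3 i l p) then show ?case by (cases s) auto
next
  case (4 i l p m q) then show ?case by (cases s) auto
qed auto

lemma before_total: "p = q \<or> before i p q \<or> before i q p"
  by (induction i p q rule: before.induct) auto

text \<open>Only a node and its descendant can be ordered differently by different indices. As the
  index grows, the ancestor moves from before to after the descendant at most once and never
  returns.\<close>

lemma before_avoids_21_12:
  "i < j \<Longrightarrow> j < k \<Longrightarrow> before i p q \<Longrightarrow> before j q p \<Longrightarrow> \<not> before k p q"
  by (induction i p q rule: before.induct) auto

text \<open>A pair is reversed from order \<open>i\<close> to order \<open>j\<close> only if its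
  first member in order \<open>i\<close> is an ancestor of the other, which lies under a child
  \<open>l\<close> with \<open>i \<le> l\<close> and \<open>l < j\<close>. So \<open>a\<close> and
  \<open>b\<close> would both be ancestors of \<open>c\<close>. The upper one has the lower one
  under the same child as \<open>c\<close>, so this pair would be reversed as well, although
  \<open>a\<close> precedes \<open>b\<close> in both orders.\<close>

lemma before_avoids_231:
  "i < j \<Longrightarrow> before i a b \<Longrightarrow> before i b c \<Longrightarrow> before j c a \<Longrightarrow> \<not> before j a b"
proof (induction i a b arbitrary: c rule: before.induct)
  case (2 i l p) then show ?case by (cases c) auto
next
  case (3 i l p) then show ?case by (cases c) auto
next
  case (4 i l p m q) then show ?case by (cases c) auto
qed auto

lemma linear_orders_before: "finite P \<Longrightarrow> linear_orders d P before"
  unfolding linear_orders_def using before_trans before_total by auto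

lemma avoiding_orders_before: "avoiding_orders d P before"
  unfolding avoiding_orders_def using before_avoids_21_12 before_avoids_231 by blast

section \<open>The orders determine the tree\<close>

text \<open>The root is the least node in order 0, so it is mapped to the root. The comparisons of a
  node with the root reveal the child under which it lies, so the isomorphism restricts to
  corresponding subtrees and induction applies.\<close>

lemma orders_iso_paths_unique:
  assumes "d > 0" "d_ary d t" "d_ary d u" "orders_iso d (paths t) before (paths u) before \<phi>"
  shows "t = u"
  using assms(2-)
proof (induction t arbitrary: u \<phi>)
  case (Node ts)
  obtain us where u: "u = Node us" by (cases u)
  let ?P = "paths (Node ts)" and ?Q = "paths (Node us)"
  have b: "bij_betw \<phi> ?P ?Q"
    and o: "\<And>i p q. i < d \<Longrightarrow> p \<in> ?P \<Longrightarrow> q \<in> ?P \<Longrightarrow> before i (\<phi> p) (\<phi> q) \<longleftrightarrow> before i p q"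
    using Node.prems(3) by (auto simp: orders_iso_def u)
  have "?P = {} \<longleftrightarrow> ?Q = {}" using b by (auto simp: bij_betw_def)
  then have emp: "ts = [] \<longleftrightarrow> us = []" by (auto simp: paths_Node split: if_splits)
  show ?case
  proof (cases "ts = []")
    case True
    then show ?thesis using emp u by simp
  next
    case False
    then have len: "length ts = d" "length us = d"
      using Node.prems(1,2) emp u by auto
    have rP: "[] \<in> ?P" and rQ: "[] \<in> ?Q" using False emp by auto
    have root: "\<phi> [] = []"
    proof (rule ccontr)
      assume ne: "\<phi> [] \<noteq> []"
      obtain q where q: "q \<in> ?P" "\<phi> q = []"
        using b rQ by (metis bij_betw_imp_surj_on imageE)
      then have "q \<noteq> []" using ne by auto
      then have "before 0 [] q" by (cases q) auto
      then have "before 0 (\<phi> []) []" using o[OF assms(1) rP q(1)] q(2) by simp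
      then show False using ne by (cases "\<phi> []") auto
    qed
    have child: "hd (\<phi> (l # p)) = l \<and> \<phi> (l # p) \<noteq> []" if "l # p \<in> ?P" for l p
    proof -
      have "\<phi> (l # p) \<noteq> []"
        using root that rP b by (metis bij_betw_inv_into_left list.distinct(1))
      then obtain m q where mq: "\<phi> (l # p) = m # q" by (cases "\<phi> (l # p)") auto
      have "m # q \<in> ?Q" using that b mq by (metis bij_betwE)
      then have "l < d" "m < d" using that len by auto
      \<comment> \<open>A node under child \<open>l\<close> follows the root exactly in the orders
        \<open>i \<le> l\<close>; taking \<open>i\<close> to be \<open>l\<close> and
        \<open>m\<close> in turn gives \<open>l = m\<close>.\<close>
      moreover have "i \<le> m \<longleftrightarrow> i \<le> l" if "i < d" for i
        using o[OF that rP \<open>l # p \<in> ?P\<close>] root mq by simp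
      ultimately have "l = m" by (meson le_antisym order_refl)
      then show ?thesis using mq by simp
    qed
    have "ts ! l = us ! l" if l: "l < d" for l
    proof -
      \<comment> \<open>By \<open>child\<close>, the image keeps the leading index \<open>l\<close>;
        removing it leaves a map between the subtrees.\<close>
      define \<psi> where "\<psi> p = tl (\<phi> (l # p))" for p
      have \<psi>: "\<phi> (l # p) = l # \<psi> p" if "p \<in> paths (ts ! l)" for p
        using child[of l p] that l len unfolding \<psi>_def by (metis Cons_in_paths_iff list.collapse)
      have "bij_betw \<psi> (paths (ts ! l)) (paths (us ! l))"
      proof (rule bij_betw_imageI)
        show "inj_on \<psi> (paths (ts ! l))"
        proof (rule inj_onI)
          fix p q assume pq: "p \<in> paths (ts ! l)" "q \<in> paths (ts ! l)" "\<psi> p = \<psi> q"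
          then have "\<phi> (l # p) = \<phi> (l # q)" using \<psi> by simp
          moreover have "l # p \<in> ?P" "l # q \<in> ?P" using pq l len by auto
          ultimately show "p = q"
            using b by (metis bij_betw_imp_inj_on inj_onD list.inject)
        qed
        show "\<psi> ` paths (ts ! l) = paths (us ! l)"
        proof (intro equalityI subsetI)
          fix q assume "q \<in> \<psi> ` paths (ts ! l)"
          then obtain p where p: "p \<in> paths (ts ! l)" "q = \<psi> p" by blast
          then have "l # q \<in> ?Q"
            using \<psi>[OF p(1)] b l len by (metis Cons_in_paths_iff bij_betwE)
          then show "q \<in> paths (us ! l)" by simp
        next
          fix q assume "q \<in> paths (us ! l)"
          then have "l # q \<in> ?Q" using l len by simp
          then obtain p where p: "p \<in> ?P" "\<phi> p = l # q"
            using b by (metis bij_betw_imp_surj_on imageE)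
          then obtain m p' where p': "p = m # p'" using root by (cases p) auto
          then have "m = l" using child p by force
          then show "q \<in> \<psi> ` paths (ts ! l)"
            using p p' \<psi>[of p'] by auto
        qed
      qed
      moreover have "before i (\<psi> p) (\<psi> q) \<longleftrightarrow> before i p q"
        if "i < d" "p \<in> paths (ts ! l)" "q \<in> paths (ts ! l)" for i p q
        using o[OF that(1), of "l # p" "l # q"] \<psi>[OF that(2)] \<psi>[OF that(3)] that l len by simp
      ultimately have "orders_iso d (paths (ts ! l)) before (paths (us ! l)) before \<psi>"
        by (simp add: orders_iso_def)
      then show ?thesis
        using Node.IH[of "ts ! l" "us ! l"] Node.prems(1,2) l len u by simp
    qed
    then show ?thesis using len u by (simp add: list_eq_iff_nth_eq)
  qed
qed

section \<open>Decomposition at the root and existence of the tree\<close>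

lemma linear_orders_least:
  assumes "linear_orders d P R" "i < d" "P \<noteq> {}"
  obtains r where "r \<in> P" "\<And>q. q \<in> P \<Longrightarrow> q \<noteq> r \<Longrightarrow> R i r q"
proof -
  obtain r where r: "r \<in> P" "\<And>q. q \<in> P \<Longrightarrow> rank P (R i) r \<le> rank P (R i) q"
    using ex_has_least_nat[of "\<lambda>x. x \<in> P" _ "rank P (R i)"] assms(3) by blast
  have "R i r q" if "q \<in> P" "q \<noteq> r" for q
    using r(2)[OF that(1)] rank_less_iff[OF assms(1,2) that(1) r(1)] assms(1,2) r(1) that
    unfolding linear_orders_def by (meson leD)
  then show ?thesis using that r(1) by blast
qed

locale avoiding_root =
  fixes d :: nat and P :: "'a set" and R :: "nat \<Rightarrow> 'a \<Rightarrow> 'a \<Rightarrow> bool" and r :: 'a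
  assumes lin: "linear_orders d P R" and av: "avoiding_orders d P R" and d: "d > 0"
    and r: "r \<in> P" and least: "q \<in> P \<Longrightarrow> q \<noteq> r \<Longrightarrow> R 0 r q"
begin

text \<open>The points destined for the subtree at child \<open>l\<close>: they compare with
  \<open>r\<close> as an address starting with \<open>l\<close> compares with \<open>[]\<close>
  under \<open>before\<close>.\<close>

definition cls :: "nat \<Rightarrow> 'a set" where
  "cls l = {q \<in> P - {r}. \<forall>i<d. R i r q \<longleftrightarrow> i \<le> l}"

lemma irrefl: "i < d \<Longrightarrow> p \<in> P \<Longrightarrow> \<not> R i p p"
  using lin unfolding linear_orders_def by metis

lemma trans: "i < d \<Longrightarrow> p \<in> P \<Longrightarrow> q \<in> P \<Longrightarrow> s \<in> P \<Longrightarrow> R i p q \<Longrightarrow> R i q s \<Longrightarrow> R i p s"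
  using lin unfolding linear_orders_def by metis

lemma total: "i < d \<Longrightarrow> p \<in> P \<Longrightarrow> q \<in> P \<Longrightarrow> p \<noteq> q \<Longrightarrow> R i p q \<or> R i q p"
  using lin unfolding linear_orders_def by metis

lemma avoids_21_12:
  "i < j \<Longrightarrow> j < k \<Longrightarrow> k < d \<Longrightarrow> p \<in> P \<Longrightarrow> q \<in> P \<Longrightarrow> R i p q \<Longrightarrow> R j q p \<Longrightarrow> \<not> R k p q"
  using av unfolding avoiding_orders_def by metis

lemma avoids_231:
  "i < j \<Longrightarrow> j < d \<Longrightarrow> a \<in> P \<Longrightarrow> b \<in> P \<Longrightarrow> c \<in> P \<Longrightarrow> R i a b \<Longrightarrow> R i b c \<Longrightarrow> R j c a \<Longrightarrow> \<not> R j a b"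
  using av unfolding avoiding_orders_def by metis

lemma cls_subset: "cls l \<subseteq> P - {r}"
  by (auto simp: cls_def)

lemma above_root: "p \<in> cls l \<Longrightarrow> i \<le> l \<Longrightarrow> i < d \<Longrightarrow> R i r p"
  by (auto simp: cls_def)

lemma below_root: "p \<in> cls l \<Longrightarrow> l < i \<Longrightarrow> i < d \<Longrightarrow> R i p r"
  using total[of i p r] r by (auto simp: cls_def)

text \<open>The indices of the orders in which \<open>q\<close> is above \<open>r\<close> include 0,
  and \<open>l\<close> is the largest of them. A gap \<open>i\<close> in between would give the
  pattern (21,12) on \<open>r\<close>, \<open>q\<close> in the orders \<open>0\<close>,
  \<open>i\<close>, \<open>l\<close>.\<close>

lemma cls_exists:
  assumes "q \<in> P" "q \<noteq> r"
  obtains l where "l < d" "q \<in> cls l"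
proof -
  define l where "l = Max {i. i < d \<and> R i r q}"
  have fin: "finite {i. i < d \<and> R i r q}" by simp
  have "0 \<in> {i. i < d \<and> R i r q}" using d least assms by simp
  then have l: "l < d" "R l r q" unfolding l_def using Max_in[OF fin] by blast+
  have "R i r q \<longleftrightarrow> i \<le> l" if i: "i < d" for i
  proof
    assume "R i r q"
    then show "i \<le> l" unfolding l_def using Max_ge[OF fin] i by simp
  next
    assume "i \<le> l"
    show "R i r q"
    proof (rule ccontr)
      assume n: "\<not> R i r q"
      then have "R i q r" using total assms r i by blast
      moreover have "i \<noteq> 0" "i \<noteq> l" using n least[OF assms] l by metis+
      ultimately show False
        using avoids_21_12[of 0 i l r q] \<open>i \<le> l\<close> l assms r least by auto
    qed
  qed
  then show ?thesis using that l assms by (simp add: cls_def)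
qed

text \<open>The bounds matter: all classes with index at least \<open>d - 1\<close>
  coincide.\<close>

lemma cls_unique:
  assumes "p \<in> cls l" "p \<in> cls m" "l < d" "m < d"
  shows "l = m"
proof -
  have "i \<le> l \<longleftrightarrow> i \<le> m" if "i < d" for i
    using assms(1,2) that by (simp add: cls_def)
  from this[OF assms(3)] this[OF assms(4)] show ?thesis by simp
qed

text \<open>This is where 231 enters: if \<open>q\<close> preceded \<open>p\<close>, these two
  points would form the pattern together with the root, unless the root already separates them in
  order \<open>i\<close>.\<close>

lemma cls_less:
  assumes p: "p \<in> cls l" and q: "q \<in> cls m" and "l < m" "m < d" "i < d"
  shows "R i p q"
proof (rule ccontr)
  assume n: "\<not> R i p q"
  have P: "p \<in> P" "q \<in> P" using p q cls_subset by auto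
  have "p \<noteq> q" using cls_unique assms by force
  then have qp: "R i q p" using total n P assms(5) by blast
  consider "i \<le> l" | "l < i" "i \<le> m" | "m < i" by linarith
  then show False
  proof cases
    \<comment> \<open>Order \<open>i\<close> reads \<open>r\<close>, \<open>q\<close>,
      \<open>p\<close>. In order \<open>l + 1\<close>, which is at most \<open>m\<close>, the root
      has passed \<open>p\<close> but not \<open>q\<close>, so that order reads \<open>p\<close>,
      \<open>r\<close>, \<open>q\<close>.\<close>
    case 1
    then show False
      using avoids_231[of i "l + 1" r q p] qp P r above_root[OF q] below_root[OF p] assms by simp
  next
    \<comment> \<open>Here the root lies between \<open>p\<close> and \<open>q\<close>.\<close>
    case 2
    then show False
      using n trans[of i p r q] P r above_root[OF q] below_root[OF p] assms by simp
  next
    \<comment> \<open>Order \<open>m\<close> reads \<open>p\<close>, \<open>r\<close>,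
      \<open>q\<close>, while the later order \<open>i\<close> reads \<open>q\<close>,
      \<open>p\<close>, \<open>r\<close>.\<close>
    case 3
    then show False
      using avoids_231[of m i p r q] qp P r above_root[OF q] below_root[OF p] below_root[OF q] assms
      by simp
  qed
qed

text \<open>The root goes to \<open>[]\<close>, and a point of class \<open>l\<close> to its address
  in the subtree with \<open>l\<close> prepended. Comparisons with the root agree by the definition
  of the classes, those between classes by \<open>cls_less\<close>, and those within a class by
  \<open>iso\<close>.\<close>

lemma orders_iso_glue:
  assumes ts: "length ts = d"
    and iso: "\<And>l. l < d \<Longrightarrow> orders_iso d (cls l) R (paths (ts ! l)) before (\<phi> l)"
  shows "\<exists>\<psi>. orders_iso d P R (paths (Node ts)) before \<psi>"
proof -
  have bij: "bij_betw (\<phi> l) (cls l) (paths (ts ! l))" if "l < d" for l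
    using iso[OF that] by (simp add: orders_iso_def)
  define idx where "idx p = (SOME l. l < d \<and> p \<in> cls l)" for p
  have idx: "idx p = l" if "l < d" "p \<in> cls l" for p l
    unfolding idx_def using that cls_unique by (intro some_equality) auto
  define \<psi> where "\<psi> p = (if p = r then [] else idx p # \<phi> (idx p) p)" for p
  have \<psi>r: "\<psi> r = []" by (simp add: \<psi>_def)
  have \<psi>c: "\<psi> p = l # \<phi> l p" if "l < d" "p \<in> cls l" for l p
    using idx[OF that] that cls_subset by (auto simp: \<psi>_def)
  have ord: "before i (\<psi> p) (\<psi> q) \<longleftrightarrow> R i p q" if i: "i < d" and p: "p \<in> P" and q: "q \<in> P" for i p q
  proof -
    consider "p = r" "q = r" | "p = r" "q \<noteq> r" | "p \<noteq> r" "q = r" | "p \<noteq> r" "q \<noteq> r" by blast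
    then show ?thesis
    proof cases
      case 1
      then show ?thesis using irrefl i r by simp
    next
      case 2
      obtain m where m: "m < d" "q \<in> cls m" using cls_exists q 2 by blast
      then show ?thesis using 2 \<psi>c[OF m] i by (simp add: \<psi>r cls_def)
    next
      case 3
      obtain l where l: "l < d" "p \<in> cls l" using cls_exists p 3 by blast
      have "\<not> (R i p r \<and> R i r p)" using trans[of i p r p] irrefl[of i p] i p r by blast
      then have "l < i \<longleftrightarrow> R i p r"
        using below_root[OF l(2), of i] above_root[OF l(2), of i] i by (meson not_le)
      then show ?thesis using 3 \<psi>c[OF l] by (simp add: \<psi>r)
    next
      case 4
      obtain l where l: "l < d" "p \<in> cls l" using cls_exists p 4 by blast
      obtain m where m: "m < d" "q \<in> cls m" using cls_exists q 4 by blast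
      consider "l < m" | "l = m" | "m < l" by linarith
      then show ?thesis
      proof cases
        case 1
        then show ?thesis using cls_less[OF l(2) m(2)] l m i \<psi>c[OF l] \<psi>c[OF m] by simp
      next
        case 2
        then show ?thesis using iso[OF l(1)] l m i \<psi>c[OF l] \<psi>c[OF m] by (simp add: orders_iso_def)
      next
        case 3
        then have "R i q p" using cls_less[OF m(2) l(2)] l i by simp
        then have "\<not> R i p q" using trans irrefl i p q by blast
        then show ?thesis using 3 \<psi>c[OF l] \<psi>c[OF m] by simp
      qed
    qed
  qed
  have "bij_betw \<psi> P (paths (Node ts))"
  proof (rule bij_betw_imageI)
    show "inj_on \<psi> P"
    proof (rule inj_onI)
      fix p q assume pq: "p \<in> P" "q \<in> P" "\<psi> p = \<psi> q"
      \<comment> \<open>Points with equal images are incomparable in order 0, as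
        \<open>before\<close> is irreflexive.\<close>
      then have "\<not> R 0 p q" "\<not> R 0 q p" using ord[OF d] by (metis before_irrefl)+
      then show "p = q" using total d pq by blast
    qed
    show "\<psi> ` P = paths (Node ts)"
    proof (intro equalityI subsetI)
      fix x assume "x \<in> \<psi> ` P"
      then obtain p where p: "p \<in> P" "x = \<psi> p" by blast
      show "x \<in> paths (Node ts)"
      proof (cases "p = r")
        case True
        then show ?thesis using p \<psi>r ts d by auto
      next
        case False
        obtain l where l: "l < d" "p \<in> cls l" using cls_exists p False by blast
        then show ?thesis using p \<psi>c[OF l] bij_betwE[OF bij[OF l(1)]] ts by simp
      qed
    next
      fix x assume x: "x \<in> paths (Node ts)"
      show "x \<in> \<psi> ` P"
      proof (cases x)
        case Nil
        then show ?thesis using \<psi>r r by (metis imageI)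
      next
        case (Cons l y)
        then have l: "l < d" "y \<in> paths (ts ! l)" using x ts by auto
        then obtain p where p: "p \<in> cls l" "\<phi> l p = y"
          using bij_betw_imp_surj_on[OF bij[OF l(1)]] by (metis imageE)
        then have "x = \<psi> p" "p \<in> P" using Cons \<psi>c[OF l(1) p(1)] cls_subset by auto
        then show ?thesis by blast
      qed
    qed
  qed
  then show ?thesis using ord unfolding orders_iso_def by blast
qed

end

text \<open>Strong induction on the number of points: each class omits the root and is therefore
  smaller, and the trees of the classes become the children.\<close>

lemma avoiding_orders_tree_exists:
  assumes "d > 0" "linear_orders d P R" "avoiding_orders d P R"
  shows "\<exists>t \<phi>. d_ary d t \<and> orders_iso d P R (paths t) before \<phi>"
  using assms(2,3)
proof (induction "card P" arbitrary: P rule: less_induct)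
  case less
  show ?case
  proof (cases "P = {}")
    case True
    then have "orders_iso d P R (paths (Node [])) before (\<lambda>_. [])"
      by (simp add: orders_iso_def paths_Node bij_betw_def)
    moreover have "d_ary d (Node [])" by simp
    ultimately show ?thesis by blast
  next
    case False
    obtain r where r: "r \<in> P" "\<And>q. q \<in> P \<Longrightarrow> q \<noteq> r \<Longrightarrow> R 0 r q"
      using linear_orders_least[OF less.prems(1) assms(1) False] by metis
    interpret avoiding_root d P R r
      by (intro avoiding_root.intro less.prems assms(1) r)
    \<comment> \<open>Proved for every \<open>l\<close>, so that trees and isomorphisms can be
      chosen as total functions; only the first \<open>d\<close> trees become children.\<close>
    have "\<exists>t \<phi>. d_ary d t \<and> orders_iso d (cls l) R (paths t) before \<phi>" for l
    proof (rule less.hyps)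
      show "card (cls l) < card P"
      proof (rule psubset_card_mono)
        show "finite P" using lin by (simp add: linear_orders_def)
        show "cls l \<subset> P" using cls_subset[of l] r(1) by blast
      qed
      show "linear_orders d (cls l) R" "avoiding_orders d (cls l) R"
        using linear_orders_subset[OF lin] avoiding_orders_subset[OF av] cls_subset[of l]
        by (meson Diff_subset subset_trans)+
    qed
    then obtain t \<phi> where t: "\<And>l. d_ary d (t l)"
      "\<And>l. orders_iso d (cls l) R (paths (t l)) before (\<phi> l)" by metis
    have "\<exists>\<psi>. orders_iso d P R (paths (Node (map t [0..<d]))) before \<psi>"
      by (rule orders_iso_glue[where \<phi> = \<phi>]) (auto simp: t)
    moreover have "d_ary d (Node (map t [0..<d]))" using t by auto
    ultimately show ?thesis by blast
  qed
qed

section \<open>The bijection\<close>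

theorem theorem2:
  fixes d n :: nat
  assumes "d \<ge> 2"
  shows "\<exists>f. bij_betw f (avoiders d n) (d_ary_trees d n)"
proof -
  have d: "d > 0" using assms by simp
  \<comment> \<open>The correspondence is first a relation. Every avoider is related to exactly one
    tree, which makes the choice in \<open>f\<close> canonical.\<close>
  define codes where "codes \<sigma> t \<longleftrightarrow> d_ary d t \<and>
    (\<exists>\<phi>. orders_iso d {1..n} (point_orders \<sigma>) (paths t) before \<phi>)" for \<sigma> t
  define f where "f \<sigma> = (SOME t. codes \<sigma> t)" for \<sigma>
  have perm: "\<sigma> \<in> d_permutations d n" if "\<sigma> \<in> avoiders d n" for \<sigma>
    using that by (simp add: avoiders_def)
  have f: "codes \<sigma> (f \<sigma>)" if "\<sigma> \<in> avoiders d n" for \<sigma>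
  proof -
    have "\<exists>t. codes \<sigma> t"
      using avoiding_orders_tree_exists[OF d linear_orders_point_orders[OF perm[OF that]]]
        avoiding_orders_point_orders[OF perm[OF that]] that
      unfolding codes_def by blast
    then show ?thesis unfolding f_def by (rule someI_ex)
  qed
  have tree: "t = u" if "codes \<sigma> t" "codes \<sigma> u" for \<sigma> t u
  proof -
    obtain \<phi> \<psi> where "orders_iso d {1..n} (point_orders \<sigma>) (paths t) before \<phi>"
      "orders_iso d {1..n} (point_orders \<sigma>) (paths u) before \<psi>"
      using \<open>codes \<sigma> t\<close> \<open>codes \<sigma> u\<close> unfolding codes_def by blast
    from orders_iso_comp[OF orders_iso_inv[OF this(1)] this(2)] show ?thesis
      using that orders_iso_paths_unique[OF d] unfolding codes_def by blast
  qed
  have "bij_betw f (avoiders d n) (d_ary_trees d n)"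
  proof (rule bij_betw_imageI)
    show "inj_on f (avoiders d n)"
    proof (rule inj_onI)
      fix \<sigma> \<tau> assume a: "\<sigma> \<in> avoiders d n" "\<tau> \<in> avoiders d n" "f \<sigma> = f \<tau>"
      obtain \<phi> \<psi> where "orders_iso d {1..n} (point_orders \<sigma>) (paths (f \<sigma>)) before \<phi>"
        "orders_iso d {1..n} (point_orders \<tau>) (paths (f \<sigma>)) before \<psi>"
        using f[OF a(1)] f[OF a(2)] a(3) unfolding codes_def by auto
      \<comment> \<open>Two avoiders with the same tree have isomorphic point orders, hence are
        equal.\<close>
      from orders_iso_comp[OF this(1) orders_iso_inv[OF this(2)]] show "\<sigma> = \<tau>"
        by (rule d_permutations_eqI[OF perm[OF a(1)] perm[OF a(2)]])
    qed
    show "f ` avoiders d n = d_ary_trees d n"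
    proof (intro equalityI subsetI)
      fix t assume "t \<in> f ` avoiders d n"
      then obtain \<sigma> where "codes \<sigma> t" using f by auto
      then obtain \<phi> where \<phi>: "d_ary d t"
        "orders_iso d {1..n} (point_orders \<sigma>) (paths t) before \<phi>"
        unfolding codes_def by blast
      then have "card {1..n} = card (paths t)"
        unfolding orders_iso_def by (meson bij_betw_same_card)
      then show "t \<in> d_ary_trees d n" using \<phi>(1) by (simp add: d_ary_trees_def card_paths)
    next
      fix t assume t: "t \<in> d_ary_trees d n"
      then have "card (paths t) = n" by (simp add: d_ary_trees_def card_paths)
      \<comment> \<open>The preimage of \<open>t\<close> is the standardisation of the traversal
        orders on its internal nodes.\<close>
      then obtain \<sigma> \<phi> where \<sigma>: "\<sigma> \<in> d_permutations d n"
        "orders_iso d {1..n} (point_orders \<sigma>) (paths t) before \<phi>"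
        using linear_orders_standardise[OF linear_orders_before[OF finite_paths] d] by blast
      then have "\<sigma> \<in> avoiders d n"
        using avoiding_orders_point_orders[OF \<sigma>(1)]
          avoiding_orders_iso[OF \<sigma>(2) avoiding_orders_before] by simp
      moreover from this have "f \<sigma> = t"
        using tree f \<sigma>(2) t unfolding codes_def d_ary_trees_def by blast
      ultimately show "t \<in> f ` avoiders d n" by blast
    qed
  qed
  then show ?thesis by blast
qed

end
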